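(* Each Tychonoff $s_{\mathbb{R}}$-space $X$ has countable $\mathbb{R}$-tightness.
   Context: A function $f:X\to\mathbb{R}$ is $s$-continuous if its restriction to each convergent sequence in $X$ (together with its limit) is continuous. A space $X$ is an $s_{\mathbb{R}}$-space if every $s$-continuous function $f:X\to\mathbb{R}$ is continuous. A space $X$ has countable $\mathbb{R}$-tightness if it is functionally generated by the family of all its countable subsets, i.e., for every discontinuous function $f:X\to\mathbb{R}$ there is a countable $M\subseteq X$ such that $f|_M$ cannot be extended to a real-valued continuous function on the whole space $X$. *)

theory Defs
  imports "HOL-Analysis.Analysis"
begin

text \<open>
  A space is an abstract topology \<open>X\<close>, and a function \<open>X \<rightarrow> \<real>\<close> is a total function
  \<open>'a \<Rightarrow> real\<close> whose values outside \<open>topspace X\<close> are irrelevant, since \<open>continuous_map\<close> does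
  not depend on them.
\<close>

text \<open>
  Every term of the sequence has to lie in the space; \<open>limitin\<close> alone constrains only
  eventually all terms.
\<close>

definition s_continuous :: "'a topology \<Rightarrow> ('a \<Rightarrow> real) \<Rightarrow> bool" where
  "s_continuous X f \<longleftrightarrow>
    (\<forall>x l. range x \<subseteq> topspace X \<and> limitin X x l sequentially \<longrightarrow>
      continuous_map (subtopology X (insert l (range x))) euclideanreal f)"

definition s_R_space :: "'a topology \<Rightarrow> bool" where
  "s_R_space X \<longleftrightarrow> (\<forall>f. s_continuous X f \<longrightarrow> continuous_map X euclideanreal f)"

definition functionally_generated :: "'a topology \<Rightarrow> 'a set set \<Rightarrow> bool" where
  "functionally_generated X \<M> \<longleftrightarrow>
    (\<forall>f. \<not> continuous_map X euclideanreal f \<longrightarrow>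
      (\<exists>M\<in>\<M>. \<not> (\<exists>g. continuous_map X euclideanreal g \<and> (\<forall>x\<in>M. g x = f x))))"

definition countable_R_tightness :: "'a topology \<Rightarrow> bool" where
  "countable_R_tightness X \<longleftrightarrow>
    functionally_generated X {M. M \<subseteq> topspace X \<and> countable M}"

definition tychonoff_space :: "'a topology \<Rightarrow> bool" where
  "tychonoff_space X \<longleftrightarrow> completely_regular_space X \<and> Hausdorff_space X"

end

theory Submission
  imports Defs
begin

theorem proposition7p5:
  fixes X :: "'a topology"
  assumes "tychonoff_space X" and "s_R_space X"
  shows "countable_R_tightness X"
  unfolding countable_R_tightness_def functionally_generated_def
proof (intro allI impI)
  fix f :: "'a \<Rightarrow> real"
  assume "\<not> continuous_map X euclideanreal f"
  then have "\<not> s_continuous X f"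
    using assms(2) unfolding s_R_space_def by blast
  then obtain x l where x: "range x \<subseteq> topspace X" and l: "limitin X x l sequentially"
    and f: "\<not> continuous_map (subtopology X (insert l (range x))) euclideanreal f"
    unfolding s_continuous_def by blast
  let ?M = "insert l (range x)"
  have "\<not> (\<exists>g. continuous_map X euclideanreal g \<and> (\<forall>y\<in>?M. g y = f y))"
  proof
    assume "\<exists>g. continuous_map X euclideanreal g \<and> (\<forall>y\<in>?M. g y = f y)"
    then obtain g where g: "continuous_map X euclideanreal g" "\<forall>y\<in>?M. g y = f y"
      by blast
    have "continuous_map (subtopology X ?M) euclideanreal g"
      using g(1) by (rule continuous_map_from_subtopology)
    then have "continuous_map (subtopology X ?M) euclideanreal f"
      by (rule continuous_map_eq) (use g(2) in auto)
    with f show False ..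
  qed
  moreover have "?M \<subseteq> topspace X" "countable ?M"
    using x l by (auto dest: limitin_topspace)
  ultimately show "\<exists>M\<in>{M. M \<subseteq> topspace X \<and> countable M}.
      \<not> (\<exists>g. continuous_map X euclideanreal g \<and> (\<forall>x\<in>M. g x = f x))"
    by blast
qed

end
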